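(* The pre-Lie exponential of the generator $x_{(0)}$ in the free Novikov algebra $\mathcal N(x)$ is given by the formula $$\exp_\triangleleft(x_{(0)})=\sum_{n\ge0}\frac{1}{(n+1)!}\sum_{\sigma\in S_n}x_{L(\sigma)}.$$
   Context: Free Novikov algebra on one generator: let $\mathcal A=\mathbb{Q}[x_i: i\ge-1]$ with derivation $\partial(x_i)=x_{i+1}$ and product $a\triangleleft b:=\partial(a)b$. $\mathcal N(x)\subset\mathcal A$ is the span of monomials of weight $-1$ (weight = sum of indices with multiplicity); it is the free (right) Novikov algebra on $x=x_{-1}$, graded by polynomial degree. For a partition $\mu=(\mu_1\ge\cdots\ge\mu_k\ge1)$ of $n$, $x_\mu:=x_{\mu_1-1}\cdots x_{\mu_k-1}x_{-1}^{n-k+1}$, homogeneous of degree $n+1$; the unique (empty) partition of $0$ is denoted $(0)$ and $x_{(0)}:=x_{-1}$. The $x_\mu$ form a basis of $\mathcal N(x)$. Infinite sums are taken in the completion of $\mathcal N(x)$ with respect to the degree grading. The pre-Lie exponential is $\exp_\triangleleft(y)=\sum_{n\ge1}\frac{1}{n!}y^{\triangleleft n}$ with $y^{\triangleleft n}=(\cdots((y\triangleleft y)\triangleleft y)\cdots)\triangleleft y$ ($n$ factors). For $\sigma\in S_n$, the Lehmer code is the word $\ell(\sigma)=l_1\cdots l_n$ with $l_i:=\#\{j>i:\sigma(j)<\sigma(i)\}$, and $L(\sigma)$ is the partition of $n$ whose parts are the multiplicities of the distinct letters occurring in $\ell(\sigma)$ (for $n=0$, $S_0$ has one element, sent to the empty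 partition $(0)$). *)

theory Defs
  imports
    Complex_Main
    "HOL-Library.Poly_Mapping"
    "HOL-Library.Multiset"
    "HOL-Combinatorics.Permutations"
    "HOL-Computational_Algebra.Formal_Power_Series"
begin

section \<open>The differential polynomial algebra\<close>

text \<open>
  The polynomial ring over the rationals in the variables \<open>x_i\<close>, \<open>i \<ge> -1\<close>. A monomial is a finitely
  supported exponent vector; the natural number \<open>k\<close> indexes the variable \<open>x_{k-1}\<close>, and \<open>X i\<close> is meant for \<open>i \<ge> -1\<close> only.
\<close>

type_synonym monom = "nat \<Rightarrow>\<^sub>0 nat"
type_synonym diff_poly = "monom \<Rightarrow>\<^sub>0 rat"

definition X :: "int \<Rightarrow> diff_poly" where
  "X i = Poly_Mapping.single (Poly_Mapping.single (nat (i + 1)) 1) 1"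

definition qscale :: "rat \<Rightarrow> diff_poly \<Rightarrow> diff_poly" where
  "qscale c p = Poly_Mapping.single 0 c * p"

definition mweight :: "monom \<Rightarrow> int" where
  "mweight m = (\<Sum>k\<in>Poly_Mapping.keys m. int (Poly_Mapping.lookup m k) * (int k - 1))"

definition mdegree :: "monom \<Rightarrow> nat" where
  "mdegree m = (\<Sum>k\<in>Poly_Mapping.keys m. Poly_Mapping.lookup m k)"

text \<open>
  The derivation with \<open>\<partial>(x_i) = x_{i+1}\<close>, written out on monomials by the Leibniz rule: each variable
  \<open>x_{k-1}\<close> of \<open>m\<close> is replaced in turn by \<open>x_k\<close>. The lemmas \<open>der_add\<close>, \<open>der_qscale\<close>, \<open>der_mult\<close>,
  \<open>der_X\<close> below characterise it.
\<close>

definition der_monom :: "monom \<Rightarrow> diff_poly" where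
  "der_monom m = (\<Sum>k\<in>Poly_Mapping.keys m.
     Poly_Mapping.single (m - Poly_Mapping.single k 1 + Poly_Mapping.single (Suc k) 1)
       (of_nat (Poly_Mapping.lookup m k)))"

definition der :: "diff_poly \<Rightarrow> diff_poly" where
  "der p = (\<Sum>m\<in>Poly_Mapping.keys p. qscale (Poly_Mapping.lookup p m) (der_monom m))"

definition tri :: "diff_poly \<Rightarrow> diff_poly \<Rightarrow> diff_poly" (infixl \<open>\<lhd>\<close> 70) where
  "a \<lhd> b = der a * b"


section \<open>The free Novikov algebra and its completion\<close>

interpretation qs: module qscale
  by unfold_locales
    (simp_all add: qscale_def algebra_simps single_add mult_single flip: mult.assoc single_one)

definition novikov :: "diff_poly set" where
  "novikov = qs.span {Poly_Mapping.single m 1 | m. mweight m = -1}"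

lift_definition homog_part :: "nat \<Rightarrow> diff_poly \<Rightarrow> diff_poly" is
  "\<lambda>d p m. if mdegree m = d then p m else 0"
  by (erule rev_finite_subset) auto

text \<open>
  The completion with respect to the degree grading is the product of the homogeneous components.
  Its elements are represented as power series whose \<open>d\<close>-th coefficient is homogeneous of degree \<open>d\<close>.
  Convergence in the library's metric on power series means that every coefficient is
  eventually constant, which is convergence in the completion; so infinite sums in the completion
  are \<open>suminf\<close> of power series.
\<close>

definition novikov_completion :: "diff_poly fps set" where
  "novikov_completion =
     {F. \<forall>d. fps_nth F d \<in> novikov \<and> homog_part d (fps_nth F d) = fps_nth F d}"

definition to_completion :: "diff_poly \<Rightarrow> diff_poly fps" where
  "to_completion p = Abs_fps (\<lambda>d. homog_part d p)"


section \<open>The pre-Lie exponential\<close>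

text \<open>\<open>tri_power y n\<close> is the left-normed product of \<open>n + 1\<close> factors \<open>y\<close>.\<close>

primrec tri_power :: "diff_poly \<Rightarrow> nat \<Rightarrow> diff_poly" where
  "tri_power y 0 = y"
| "tri_power y (Suc n) = tri_power y n \<lhd> y"

definition exp_tri_term :: "diff_poly \<Rightarrow> nat \<Rightarrow> diff_poly" where
  "exp_tri_term y n = qscale (1 / fact (n + 1)) (tri_power y n)"

definition exp_tri :: "diff_poly \<Rightarrow> diff_poly fps" where
  "exp_tri y = suminf (\<lambda>n. to_completion (exp_tri_term y n))"


section \<open>Partitions and Lehmer codes\<close>

text \<open>
  A partition of \<open>n\<close> is a multiset of positive natural numbers with sum \<open>n\<close>;
  the empty multiset is the partition of \<open>0\<close>.
\<close>

definition x_part :: "nat multiset \<Rightarrow> diff_poly" where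
  "x_part \<mu> = (\<Prod>m\<in>#\<mu>. X (int m - 1)) * X (-1) ^ (sum_mset \<mu> - size \<mu> + 1)"

definition lehmer_code :: "nat \<Rightarrow> (nat \<Rightarrow> nat) \<Rightarrow> nat list" where
  "lehmer_code n \<sigma> = map (\<lambda>i. card {j. i < j \<and> j \<le> n \<and> \<sigma> j < \<sigma> i}) [1..<n + 1]"

definition lehmer_partition :: "nat \<Rightarrow> (nat \<Rightarrow> nat) \<Rightarrow> nat multiset" where
  "lehmer_partition n \<sigma> =
     image_mset (count (mset (lehmer_code n \<sigma>))) (mset_set (set (lehmer_code n \<sigma>)))"


section \<open>Basic facts\<close>

lemma lehmer_partition_is_partition:
  "0 \<notin># lehmer_partition n \<sigma>" "sum_mset (lehmer_partition n \<sigma>) = n"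
proof -
  show "0 \<notin># lehmer_partition n \<sigma>"
    by (auto simp: lehmer_partition_def)
  have "sum_mset (lehmer_partition n \<sigma>) = size (mset (lehmer_code n \<sigma>))"
    by (simp add: lehmer_partition_def size_multiset_overloaded_eq
        flip: sum_unfold_sum_mset)
  then show "sum_mset (lehmer_partition n \<sigma>) = n"
    by (simp add: lehmer_code_def)
qed

lemma der_eq_superset:
  assumes "finite S" "Poly_Mapping.keys p \<subseteq> S"
  shows "der p = (\<Sum>m\<in>S. qscale (Poly_Mapping.lookup p m) (der_monom m))"
  unfolding der_def
  by (rule sum.mono_neutral_left) (use assms in \<open>auto simp: in_keys_iff\<close>)

lemma der_add: "der (p + q) = der p + der q"
proof -
  let ?S = "Poly_Mapping.keys p \<union> Poly_Mapping.keys q"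
  have "Poly_Mapping.keys (p + q) \<subseteq> ?S"
    by (rule keys_add)
  then show ?thesis
    by (simp add: der_eq_superset[of ?S] lookup_add qs.scale_left_distrib sum.distrib)
qed

lemma der_0 [simp]: "der 0 = 0"
  by (simp add: der_def)

lemma der_single: "der (Poly_Mapping.single m c) = qscale c (der_monom m)"
  by (cases "c = 0") (simp_all add: der_def)

lemma der_sum: "der (sum f S) = (\<Sum>s\<in>S. der (f s))"
  by (induction S rule: infinite_finite_induct) (simp_all add: der_add)

lemma poly_as_sum:
  "(p :: diff_poly) =
    (\<Sum>m\<in>Poly_Mapping.keys p. Poly_Mapping.single m (Poly_Mapping.lookup p m))"
  by (rule poly_mapping_eqI) (auto simp: lookup_sum lookup_single when_def in_keys_iff)

lemma der_monom_eq_superset: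
  assumes "finite S" "Poly_Mapping.keys m \<subseteq> S"
  shows "der_monom m = (\<Sum>k\<in>S.
     Poly_Mapping.single (m - Poly_Mapping.single k 1 + Poly_Mapping.single (Suc k) 1)
       (of_nat (Poly_Mapping.lookup m k)))"
  unfolding der_monom_def
  by (rule sum.mono_neutral_left) (use assms in \<open>auto simp: in_keys_iff\<close>)

lemma monom_shift:
  assumes "Poly_Mapping.lookup (m :: monom) k \<noteq> 0"
  shows "m + n - Poly_Mapping.single k 1 + Poly_Mapping.single l 1 =
    (m - Poly_Mapping.single k 1 + Poly_Mapping.single l 1) + n"
  using assms by (intro poly_mapping_eqI) (auto simp: lookup_add lookup_minus lookup_single when_def)

lemma der_monom_add:
  "der_monom (m + n) =
     der_monom m * Poly_Mapping.single n 1 + Poly_Mapping.single m 1 * der_monom n"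
proof -
  let ?S = "Poly_Mapping.keys m \<union> Poly_Mapping.keys n"
  let ?t = "\<lambda>m k. m - Poly_Mapping.single k 1 + Poly_Mapping.single (Suc k) (1::nat)"
  have "Poly_Mapping.keys (m + n) \<subseteq> ?S"
    by (rule keys_add)
  moreover have "Poly_Mapping.single (?t (m + n) k) (of_nat (Poly_Mapping.lookup (m + n) k)) =
      Poly_Mapping.single (?t m k) (of_nat (Poly_Mapping.lookup m k)) * Poly_Mapping.single n 1 +
      Poly_Mapping.single m 1 * Poly_Mapping.single (?t n k) (of_nat (Poly_Mapping.lookup n k) :: rat)"
    for k
    using monom_shift[of m k n "Suc k"] monom_shift[of n k m "Suc k"]
    by (cases "Poly_Mapping.lookup m k = 0"; cases "Poly_Mapping.lookup n k = 0")
      (simp_all add: mult_single lookup_add single_add add.commute)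
  ultimately show ?thesis
    by (simp add: der_monom_eq_superset[of ?S] sum_distrib_left sum_distrib_right sum.distrib)
qed

lemma single_conv_qscale: "Poly_Mapping.single m c = qscale c (Poly_Mapping.single m 1)"
  by (simp add: qscale_def mult_single)

lemma qscale_mult_left: "qscale c p * q = qscale c (p * q)"
  and qscale_mult_right: "p * qscale c q = qscale c (p * q)"
  by (simp_all add: qscale_def mult_ac)

lemma der_mult: "der (p * q) = der p * q + p * der q"
proof -
  have single: "der (Poly_Mapping.single m c * Poly_Mapping.single n d) =
      der (Poly_Mapping.single m c) * Poly_Mapping.single n d +
      Poly_Mapping.single m c * der (Poly_Mapping.single n d)" for m n c d
    unfolding mult_single der_single der_monom_add
    by (simp add: single_conv_qscale[of m c] single_conv_qscale[of n d] qscale_mult_left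
        qscale_mult_right qs.scale_right_distrib mult.commute[of c d])
  let ?s = "\<lambda>p m. Poly_Mapping.single m (Poly_Mapping.lookup p m)"
  have "der (p * q) = der (sum (?s p) (Poly_Mapping.keys p) * sum (?s q) (Poly_Mapping.keys q))"
    by (simp flip: poly_as_sum)
  also have "\<dots> = der (sum (?s p) (Poly_Mapping.keys p)) * sum (?s q) (Poly_Mapping.keys q) +
      sum (?s p) (Poly_Mapping.keys p) * der (sum (?s q) (Poly_Mapping.keys q))"
    by (simp add: sum_product der_sum single sum.distrib)
  finally show ?thesis
    by (simp flip: poly_as_sum)
qed

lemma der_qscale: "der (qscale c p) = qscale c (der p)"
  unfolding qscale_def der_mult by (simp add: der_single der_monom_def)

lemma der_X: "i \<ge> -1 \<Longrightarrow> der (X i) = X (i + 1)"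
  by (simp add: X_def der_single der_monom_def nat_add_distrib[of "i + 1" 1, simplified] Suc_nat_eq_nat_zadd1 add.commute)

lemma mweight_eq_superset:
  assumes "finite S" "Poly_Mapping.keys m \<subseteq> S"
  shows "mweight m = (\<Sum>k\<in>S. int (Poly_Mapping.lookup m k) * (int k - 1))"
  unfolding mweight_def
  by (rule sum.mono_neutral_left) (use assms in \<open>auto simp: in_keys_iff\<close>)

lemma mweight_add: "mweight (m + n) = mweight m + mweight n"
proof -
  let ?S = "Poly_Mapping.keys m \<union> Poly_Mapping.keys n"
  have "Poly_Mapping.keys (m + n) \<subseteq> ?S"
    by (rule keys_add)
  then show ?thesis
    by (simp add: mweight_eq_superset[of ?S] lookup_add distrib_right sum.distrib)
qed

lemma mweight_single: "mweight (Poly_Mapping.single k c) = int c * (int k - 1)"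
  by (cases "c = 0") (simp_all add: mweight_def)

lemma monom_minus_plus:
  assumes "Poly_Mapping.lookup (m :: monom) k \<noteq> 0"
  shows "m - Poly_Mapping.single k 1 + Poly_Mapping.single k 1 = m"
  using assms by (intro poly_mapping_eqI) (auto simp: lookup_add lookup_minus lookup_single when_def)

lemma mem_novikov_iff:
  "p \<in> novikov \<longleftrightarrow> (\<forall>m\<in>Poly_Mapping.keys p. mweight m = -1)"
proof
  assume "p \<in> novikov"
  then show "\<forall>m\<in>Poly_Mapping.keys p. mweight m = -1"
    unfolding novikov_def
  proof (induction rule: qs.span_induct_alt)
    case base
    then show ?case by simp
  next
    case (step c x y)
    then obtain m where m: "x = Poly_Mapping.single m 1" "mweight m = -1"
      by auto
    have "Poly_Mapping.keys (qscale c x + y) \<subseteq> insert m (Poly_Mapping.keys y)"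
      using keys_add[of "qscale c x" y] m by (auto simp flip: single_conv_qscale split: if_splits)
    with step m show ?case by auto
  qed
next
  assume *: "\<forall>m\<in>Poly_Mapping.keys p. mweight m = -1"
  have "(\<Sum>m\<in>Poly_Mapping.keys p. Poly_Mapping.single m (Poly_Mapping.lookup p m)) \<in> novikov"
    unfolding novikov_def
  proof (rule qs.span_sum)
    fix m assume "m \<in> Poly_Mapping.keys p"
    with * have "Poly_Mapping.single m 1 \<in> qs.span {Poly_Mapping.single m 1 |m. mweight m = -1}"
      by (intro qs.span_base) auto
    then show "Poly_Mapping.single m (Poly_Mapping.lookup p m)
        \<in> qs.span {Poly_Mapping.single m 1 |m. mweight m = -1}"
      by (subst single_conv_qscale) (rule qs.span_scale)
  qed
  then show "p \<in> novikov" by (simp flip: poly_as_sum)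
qed

lemma keys_der:
  assumes "m \<in> Poly_Mapping.keys (der p)"
  obtains n where "n \<in> Poly_Mapping.keys p" "mweight m = mweight n + 1"
proof -
  have "Poly_Mapping.lookup (der p) m \<noteq> 0"
    using assms by (simp add: in_keys_iff)
  then obtain n where n: "n \<in> Poly_Mapping.keys p"
    and "Poly_Mapping.lookup (qscale (Poly_Mapping.lookup p n) (der_monom n)) m \<noteq> 0"
    unfolding der_def lookup_sum by (meson sum.neutral)
  then obtain k where k: "k \<in> Poly_Mapping.keys n"
    and m: "m = n - Poly_Mapping.single k 1 + Poly_Mapping.single (Suc k) 1"
    unfolding der_monom_def qs.scale_sum_right lookup_sum
    by (auto elim!: sum.not_neutral_contains_not_neutral
        simp: qscale_def mult_single lookup_single when_def split: if_splits)
  have "mweight n = mweight (n - Poly_Mapping.single k 1 + Poly_Mapping.single k 1)"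
    using k monom_minus_plus[of n k] by (simp add: in_keys_iff)
  then have "mweight m = mweight n + 1"
    by (simp add: m mweight_add mweight_single)
  with n show thesis by (rule that)
qed

lemma tri_mem_novikov:
  assumes "a \<in> novikov" "b \<in> novikov"
  shows "a \<lhd> b \<in> novikov"
  unfolding mem_novikov_iff
proof
  fix m assume "m \<in> Poly_Mapping.keys (a \<lhd> b)"
  then obtain m1 m2 where "m = m1 + m2" "m1 \<in> Poly_Mapping.keys (der a)"
    "m2 \<in> Poly_Mapping.keys b"
    using keys_mult[of "der a" b] by (auto simp: tri_def)
  with assms show "mweight m = -1"
    by (auto simp: mweight_add mem_novikov_iff elim!: keys_der)
qed

lemma X_minus1_mem_novikov: "X (-1) \<in> novikov"
  by (simp add: mem_novikov_iff X_def mweight_single)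

lemma x_part_empty: "x_part {#} = X (-1)"
  by (simp add: x_part_def)

lemma X_power_eq_single:
  "X (-1) ^ r = Poly_Mapping.single (Poly_Mapping.single 0 r) 1"
  by (induction r) (simp_all add: X_def mult_single flip: single_add)

lemma x_part_mem_novikov:
  assumes "0 \<notin># \<mu>"
  shows "x_part \<mu> \<in> novikov"
proof -
  have "\<exists>M. (\<Prod>m\<in>#\<mu>. X (int m - 1)) = Poly_Mapping.single M 1 \<and>
      mweight M = int (sum_mset \<mu>) - int (size \<mu>) \<and> size \<mu> \<le> sum_mset \<mu>"
    using assms
  proof (induction \<mu>)
    case empty
    have "(1 :: diff_poly) = Poly_Mapping.single 0 1 \<and> mweight 0 = 0"
      by (simp add: mweight_def)
    then show ?case by (intro exI[of _ 0]) simp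
  next
    case (add k \<mu>)
    then obtain M where "(\<Prod>m\<in>#\<mu>. X (int m - 1)) = Poly_Mapping.single M 1"
      "mweight M = int (sum_mset \<mu>) - int (size \<mu>)" "size \<mu> \<le> sum_mset \<mu>" by auto
    with add.prems show ?case
      by (intro exI[of _ "Poly_Mapping.single k 1 + M"])
        (auto simp: X_def mult_single mweight_add mweight_single)
  qed
  then obtain M where M: "(\<Prod>m\<in>#\<mu>. X (int m - 1)) = Poly_Mapping.single M 1"
      "mweight M = int (sum_mset \<mu>) - int (size \<mu>)" "size \<mu> \<le> sum_mset \<mu>"
    by blast
  then have "x_part \<mu> =
      Poly_Mapping.single (M + Poly_Mapping.single 0 (sum_mset \<mu> - size \<mu> + 1)) 1"
    unfolding x_part_def X_power_eq_single by (simp only: mult_single mult_1_left)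
  moreover have "mweight (M + Poly_Mapping.single 0 (sum_mset \<mu> - size \<mu> + 1)) = -1"
    unfolding mweight_add mweight_single M(2) using M(3) by (simp add: of_nat_diff)
  ultimately show ?thesis
    by (simp only: mem_novikov_iff) simp
qed

lemma to_completion_mem:
  assumes "p \<in> novikov"
  shows "to_completion p \<in> novikov_completion"
proof -
  have "Poly_Mapping.keys (homog_part d p) \<subseteq> Poly_Mapping.keys p" for d
    by transfer auto
  moreover have "homog_part d (homog_part d p) = homog_part d p" for d
    by transfer auto
  ultimately show ?thesis
    using assms by (auto simp: novikov_completion_def to_completion_def mem_novikov_iff)
qed

lemma homog_part_add: "homog_part d (p + q) = homog_part d p + homog_part d q"
  by transfer auto

lemma homog_part_0: "homog_part d 0 = 0"
  by transfer auto

lemma suminf_mem_completion: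
  assumes "\<And>n. a n \<in> novikov_completion" "summable a"
  shows "suminf a \<in> novikov_completion"
proof -
  have part: "sum a S \<in> novikov_completion" for S :: "nat set"
  proof (induction S rule: infinite_finite_induct)
    case (insert x S)
    with assms(1)[of x] show ?case
      by (auto simp: novikov_completion_def homog_part_add novikov_def intro: qs.span_add)
  qed (auto simp: novikov_completion_def homog_part_0 novikov_def intro: qs.span_zero)
  have lim: "(\<lambda>n. sum a {..<n}) \<longlonglongrightarrow> suminf a"
    using assms(2) by (simp add: summable_LIMSEQ)
  have "\<exists>S. fps_nth (suminf a) d = fps_nth (sum a S) d" for d
  proof -
    have "eventually (\<lambda>n. fps_nth (sum a {..<n}) d = fps_nth (suminf a) d) sequentially"
      using lim by (simp add: tendsto_fps_iff)
    then show ?thesis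
      by (auto simp: eventually_sequentially intro: sym)
  qed
  note coeff = this
  have "fps_nth (suminf a) d \<in> novikov \<and>
      homog_part d (fps_nth (suminf a) d) = fps_nth (suminf a) d" for d
  proof -
    obtain S where "fps_nth (suminf a) d = fps_nth (sum a S) d"
      using coeff by blast
    with part[of S] show ?thesis
      by (simp add: novikov_completion_def)
  qed
  then show ?thesis
    by (simp add: novikov_completion_def)
qed

end

theory Submission
  imports Defs
begin

text \<open>
  A Lehmer code of length \<open>n\<close> uses letters from \<open>{0..<n}\<close>, so its monomial can be written as the product
  of \<open>x_{m(v)-1}\<close> over all \<open>v \<in> {0..n}\<close>, where \<open>m(v)\<close> is the multiplicity of the letter \<open>v\<close>: the
  letters that do not occur account for the power of \<open>x_{-1}\<close>. By the Leibniz rule, \<open>\<partial>\<close> raises one of the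
  multiplicities, that is, it prepends an arbitrary letter \<open>c \<in> {0..n}\<close>; multiplying by \<open>x_{-1}\<close>
  supplies the factor of the new unused letter \<open>n + 1\<close>. Since \<open>c # w\<close> with \<open>c \<le> n\<close> and
  \<open>w\<close> a code of length \<open>n\<close> are exactly the codes of length \<open>n + 1\<close>, the two sides agree degree by degree.
\<close>

primrec codes :: "nat \<Rightarrow> nat list set" where
  "codes 0 = {[]}"
| "codes (Suc n) = (\<lambda>(c, w). c # w) ` ({..n} \<times> codes n)"

lemma finite_codes: "finite (codes n)"
  by (induction n) auto

lemma card_codes: "card (codes n) = fact n"
proof (induction n)
  case (Suc n)
  have "card (codes (Suc n)) = card ({..n} \<times> codes n)"
    unfolding codes.simps by (intro card_image) (auto simp: inj_on_def)
  with Suc show ?case by (simp add: card_cartesian_product)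
qed simp

lemma codes_letters: "w \<in> codes n \<Longrightarrow> set w \<subseteq> {..<n}"
  by (induction n arbitrary: w) fastforce+

lemma mem_codesI:
  assumes "length w = n" "\<And>i. i < n \<Longrightarrow> w ! i < n - i"
  shows "w \<in> codes n"
  using assms
proof (induction n arbitrary: w)
  case (Suc n)
  then obtain c u where w: "w = c # u" "length u = n"
    by (auto simp: length_Suc_conv)
  have "u \<in> codes n"
  proof (rule Suc.IH)
    fix i assume "i < n"
    then show "u ! i < n - i" using Suc.prems(2)[of "Suc i"] w by simp
  qed (fact w(2))
  moreover have "c \<le> n" using Suc.prems(2)[of 0] w by simp
  ultimately show ?case using w by auto
qed simp

lemma lehmer_code_mem_codes: "lehmer_code n \<sigma> \<in> codes n"
proof (rule mem_codesI)
  fix i assume i: "i < n"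
  \<comment> \<open>List position \<open>i\<close> holds the letter of index \<open>Suc i\<close>,
    which counts among the \<open>n - i - 1\<close> later indices; hence the strict bound
    \<open>n - i\<close>.\<close>
  have "card {j. Suc i < j \<and> j \<le> n \<and> \<sigma> j < \<sigma> (Suc i)} \<le> card {Suc (Suc i)..n}"
    by (intro card_mono) auto
  with i show "lehmer_code n \<sigma> ! i < n - i"
    by (auto simp: lehmer_code_def simp del: upt_Suc)
qed (simp add: lehmer_code_def)

text \<open>This makes the letter at \<open>i\<close> the rank of \<open>\<sigma> i\<close> in the
  set of values taken from \<open>i\<close> on, so that two permutations sharing this set can be
  compared.\<close>

lemma card_inversions_eq_card_values:
  fixes \<sigma> :: "nat \<Rightarrow> nat"
  assumes "\<sigma> permutes {1..n}"
  shows "card {j. i < j \<and> j \<le> n \<and> \<sigma> j < \<sigma> i} = card {r \<in> \<sigma> ` {i..n}. r < \<sigma> i}"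
proof -
  have "{r \<in> \<sigma> ` {i..n}. r < \<sigma> i} = \<sigma> ` {j. i < j \<and> j \<le> n \<and> \<sigma> j < \<sigma> i}"
    by (force simp: order_le_less)
  then show ?thesis
    using permutes_inj[OF assms] by (simp add: card_image inj_on_subset)
qed

text \<open>Decoding goes from left to right: if two permutations agree before \<open>i\<close>, the
  same values remain for \<open>{i..n}\<close>, and the letter, being a rank in this common set,
  determines the value at \<open>i\<close>.\<close>

lemma inj_on_lehmer_code: "inj_on (lehmer_code n) {\<sigma>. \<sigma> permutes {1..n}}"
proof (rule inj_onI)
  fix \<sigma> \<tau> assume "\<sigma> \<in> {\<sigma>. \<sigma> permutes {1..n}}" "\<tau> \<in> {\<sigma>. \<sigma> permutes {1..n}}"
  then have s: "\<sigma> permutes {1..n}" and t: "\<tau> permutes {1..n}" by auto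
  assume eq: "lehmer_code n \<sigma> = lehmer_code n \<tau>"
  have code: "card {r \<in> \<sigma> ` {i..n}. r < \<sigma> i} = card {r \<in> \<tau> ` {i..n}. r < \<tau> i}"
    if "i \<in> {1..n}" for i
    using eq that
    by (simp add: lehmer_code_def card_inversions_eq_card_values[OF s]
        card_inversions_eq_card_values[OF t] del: upt_Suc)
  have tail: "\<rho> ` {i..n} = {1..n} - \<rho> ` {1..<i}"
    if "\<rho> permutes {1..n}" "i \<in> {1..n}" for \<rho> :: "nat \<Rightarrow> nat" and i
  proof -
    have "{i..n} = {1..n} - {1..<i}" using that(2) by auto
    then show ?thesis
      using that(1) by (simp add: image_set_diff permutes_inj permutes_image)
  qed
  have "i \<in> {1..n} \<Longrightarrow> \<sigma> i = \<tau> i" for i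
  proof (induction i rule: less_induct)
    case (less i)
    then have "\<sigma> ` {1..<i} = \<tau> ` {1..<i}"
      by (intro image_cong) auto
    then have R: "\<sigma> ` {i..n} = \<tau> ` {i..n}"
      using tail[OF s less.prems] tail[OF t less.prems] by simp
    \<comment> \<open>Ranks are strictly monotone on \<open>R\<close>, because \<open>a\<close>
      itself is counted only on the right.\<close>
    have strict: "card {r \<in> R. r < a} < card {r \<in> R. r < b}"
      if "finite R" "a \<in> R" "a < b" for R and a b :: nat
      using that by (intro psubset_card_mono) auto
    have "\<sigma> i \<in> \<sigma> ` {i..n}" and "\<tau> i \<in> \<tau> ` {i..n}"
      using less.prems by auto
    then have mem: "\<sigma> i \<in> \<tau> ` {i..n}" "\<tau> i \<in> \<tau> ` {i..n}"
      by (simp_all only: R)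
    show ?case
      using strict[OF _ mem(1), of "\<tau> i"] strict[OF _ mem(2), of "\<sigma> i"] code[OF less.prems]
      by (cases "\<sigma> i" "\<tau> i" rule: linorder_cases) (simp_all add: R)
  qed
  then show "\<sigma> = \<tau>"
    using permutes_not_in[OF s] permutes_not_in[OF t] by (metis ext)
qed

text \<open>Surjectivity comes from counting: both sets have \<open>fact n\<close> elements, so the
  injection is onto.\<close>

lemma bij_betw_lehmer_code: "bij_betw (lehmer_code n) {\<sigma>. \<sigma> permutes {1..n}} (codes n)"
  unfolding bij_betw_def
proof
  have "card {\<sigma>. \<sigma> permutes {1..n}} = fact n"
    by (rule card_permutations) auto
  then show "lehmer_code n ` {\<sigma>. \<sigma> permutes {1..n}} = codes n"
    using card_image[OF inj_on_lehmer_code, of n]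
    by (intro card_subset_eq) (auto simp: finite_codes card_codes lehmer_code_mem_codes)
qed (fact inj_on_lehmer_code)

text \<open>The letters of a code lie below \<open>n\<close>, so its factor at \<open>n\<close> is
  always \<open>X (-1)\<close>; with it there are \<open>n + 1\<close> factors, the degree of
  \<open>x_part \<mu>\<close> for a partition of \<open>n\<close>.\<close>

definition code_monom :: "nat \<Rightarrow> nat list \<Rightarrow> diff_poly" where
  "code_monom n w = (\<Prod>v\<le>n. X (int (count (mset w) v) - 1))"

text \<open>The letters that occur give the parts of the partition, and the other letters up to
  \<open>n\<close> give factors \<open>X (-1)\<close>. Their number is the exponent in
  \<open>x_part\<close>, since the partition has sum \<open>n\<close> and one part per distinct
  letter.\<close>

lemma x_part_lehmer_partition: "x_part (lehmer_partition n \<sigma>) = code_monom n (lehmer_code n \<sigma>)"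
proof -
  let ?w = "lehmer_code n \<sigma>"
  have "set ?w \<subseteq> {..<n}" by (rule codes_letters[OF lehmer_code_mem_codes])
  then have sub: "set ?w \<subseteq> {..n}" and le: "card (set ?w) \<le> n"
    using card_mono[of "{..<n}" "set ?w"] by auto
  have unused: "count (mset ?w) v = 0" if "v \<notin> set ?w" for v
    using that by (simp add: count_eq_zero_iff)
  have "code_monom n ?w = (\<Prod>v\<in>set ?w. X (int (count (mset ?w) v) - 1)) *
      (\<Prod>v\<in>{..n} - set ?w. X (int (count (mset ?w) v) - 1))"
    unfolding code_monom_def using sub by (subst prod.subset_diff[of "set ?w"]) (auto simp: mult.commute)
  also have "(\<Prod>v\<in>{..n} - set ?w. X (int (count (mset ?w) v) - 1)) = (\<Prod>v\<in>{..n} - set ?w. X (-1))"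
    by (intro prod.cong) (simp_all add: unused)
  also have "\<dots> = X (-1) ^ (n - card (set ?w) + 1)"
    using sub le by (simp add: card_Diff_subset Suc_diff_le)
  also have "(\<Prod>v\<in>set ?w. X (int (count (mset ?w) v) - 1)) =
      (\<Prod>m\<in>#lehmer_partition n \<sigma>. X (int m - 1))"
    by (simp add: lehmer_partition_def prod_unfold_prod_mset image_mset.compositionality o_def)
  finally show ?thesis
    unfolding x_part_def lehmer_partition_is_partition
    by (simp add: lehmer_partition_def)
qed

lemma der_prod:
  assumes "finite S"
  shows "der (prod f S) = (\<Sum>s\<in>S. der (f s) * prod f (S - {s}))"
  using assms
proof (induction S rule: finite_induct)
  case empty
  then show ?case by (simp add: der_single der_monom_def flip: single_one)
next
  case (insert a S)
  have "prod f (insert a S - {s}) = f a * prod f (S - {s})" if "s \<in> S" for s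
  proof -
    have "insert a S - {s} = insert a (S - {s})" using that insert.hyps by auto
    then show ?thesis using insert.hyps by simp
  qed
  then have "(\<Sum>s\<in>S. der (f s) * prod f (insert a S - {s})) =
      f a * (\<Sum>s\<in>S. der (f s) * prod f (S - {s}))"
    by (simp add: sum_distrib_left mult_ac)
  with insert show ?case
    by (simp add: der_mult)
qed

lemma code_monom_tri_X:
  assumes "w \<in> codes n"
  shows "code_monom n w \<lhd> X (-1) = (\<Sum>c\<le>n. code_monom (Suc n) (c # w))"
proof -
  let ?f = "\<lambda>w v. X (int (count (mset w) v) - 1)"
  have unused: "count (mset w) (Suc n) = 0"
    using codes_letters[OF assms] by (auto simp: count_eq_zero_iff)
  have new: "code_monom (Suc n) (c # w) = code_monom n (c # w) * X (-1)" if "c \<le> n" for c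
    using that by (simp add: code_monom_def unused)
  have "der (?f w c) * prod (?f w) ({..n} - {c}) = code_monom n (c # w)" if "c \<le> n" for c
  proof -
    have "prod (?f (c # w)) ({..n} - {c}) = prod (?f w) ({..n} - {c})"
      by (intro prod.cong) auto
    \<comment> \<open>Multiplicities are nonnegative, so the index is at least \<open>-1\<close>, as
      \<open>der_X\<close> requires.\<close>
    moreover have "?f (c # w) c = der (?f w c)"
      by (simp add: der_X)
    ultimately show ?thesis
      using that prod.remove[of "{..n}" c "?f (c # w)"] by (simp add: code_monom_def)
  qed
  then have "der (code_monom n w) = (\<Sum>c\<le>n. code_monom n (c # w))"
    by (simp add: code_monom_def[of n w] der_prod)
  then show ?thesis
    by (simp add: tri_def new sum_distrib_right)
qed

lemma tri_power_eq_sum_codes: "tri_power (X (-1)) n = (\<Sum>w\<in>codes n. code_monom n w)"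
proof (induction n)
  case 0
  show ?case by (simp add: code_monom_def)
next
  case (Suc n)
  have "tri_power (X (-1)) (Suc n) = (\<Sum>w\<in>codes n. code_monom n w \<lhd> X (-1))"
    by (simp add: Suc tri_def der_sum sum_distrib_right)
  also have "\<dots> = (\<Sum>w\<in>codes n. \<Sum>c\<le>n. code_monom (Suc n) (c # w))"
    by (simp add: code_monom_tri_X)
  also have "\<dots> = (\<Sum>(c, w)\<in>{..n} \<times> codes n. code_monom (Suc n) (c # w))"
    by (subst sum.swap) (simp add: sum.cartesian_product)
  also have "\<dots> = (\<Sum>w\<in>codes (Suc n). code_monom (Suc n) w)"
    unfolding codes.simps by (subst sum.reindex) (auto simp: inj_on_def case_prod_beta)
  finally show ?case .
qed

lemma tri_power_eq_sum_permutations: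
  "tri_power (X (-1)) n = (\<Sum>\<sigma> | \<sigma> permutes {1..n}. x_part (lehmer_partition n \<sigma>))"
  unfolding x_part_lehmer_partition tri_power_eq_sum_codes
  by (rule sum.reindex_bij_betw[OF bij_betw_lehmer_code, symmetric])

lemma mdegree_add: "mdegree (m + n) = mdegree m + mdegree n"
proof -
  have superset: "mdegree k = (\<Sum>i\<in>S. Poly_Mapping.lookup k i)"
    if "finite S" "Poly_Mapping.keys k \<subseteq> S" for k S
    unfolding mdegree_def
    by (rule sum.mono_neutral_left) (use that in \<open>auto simp: in_keys_iff\<close>)
  let ?S = "Poly_Mapping.keys m \<union> Poly_Mapping.keys n"
  have "Poly_Mapping.keys (m + n) \<subseteq> ?S"
    by (rule keys_add)
  then show ?thesis
    by (simp add: superset[of ?S] lookup_add sum.distrib)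
qed

text \<open>Every \<open>X i\<close> is a single variable, even for \<open>i\<close> below
  \<open>-1\<close> where \<open>nat\<close> truncates, so each factor adds exactly one to the
  degree.\<close>

lemma prod_X_eq_single:
  assumes "finite S"
  shows "\<exists>m. (\<Prod>v\<in>S. X (f v)) = Poly_Mapping.single m 1 \<and> mdegree m = card S"
  using assms
proof (induction S rule: finite_induct)
  case empty
  show ?case by (intro exI[of _ 0]) (simp add: mdegree_def)
next
  case (insert a S)
  then obtain m where "(\<Prod>v\<in>S. X (f v)) = Poly_Mapping.single m 1" "mdegree m = card S"
    by blast
  with insert.hyps show ?case
    by (intro exI[of _ "Poly_Mapping.single (nat (f a + 1)) 1 + m"])
      (simp add: X_def mult_single mdegree_add mdegree_def[of "Poly_Mapping.single _ _"])
qed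

lemma homog_part_sum: "homog_part d (sum f S) = (\<Sum>s\<in>S. homog_part d (f s))"
  by (induction S rule: infinite_finite_induct) (simp_all add: homog_part_add homog_part_0)

lemma homog_part_single:
  "homog_part d (Poly_Mapping.single m c) = (if mdegree m = d then Poly_Mapping.single m c else 0)"
  by (rule poly_mapping_eqI) (auto simp: homog_part.rep_eq lookup_single when_def)

text \<open>Each code monomial is a product of \<open>n + 1\<close> variables, so term
  \<open>n\<close> lives in degree \<open>n + 1\<close> alone.\<close>

lemma homog_part_exp_tri_term:
  assumes "d \<noteq> Suc n"
  shows "homog_part d (exp_tri_term (X (-1)) n) = 0"
proof -
  have "homog_part d (qscale c (code_monom n w)) = 0" for c w
  proof -
    obtain m where "code_monom n w = Poly_Mapping.single m 1" "mdegree m = Suc n"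
      unfolding code_monom_def using prod_X_eq_single[of "{..n}"] by fastforce
    then show ?thesis
      using assms by (simp add: homog_part_single flip: single_conv_qscale)
  qed
  then show ?thesis
    by (simp add: exp_tri_term_def tri_power_eq_sum_codes qs.scale_sum_right homog_part_sum)
qed

text \<open>Only the terms with \<open>n \<le> d\<close> reach coefficient \<open>d\<close>, so
  along the partial sums it is constant once \<open>N > d\<close>.\<close>

lemma summable_fpsI:
  fixes a :: "nat \<Rightarrow> 'a::comm_ring_1 fps"
  assumes "\<And>n d. d < n \<Longrightarrow> fps_nth (a n) d = 0"
  shows "summable a"
proof -
  let ?F = "Abs_fps (\<lambda>d. \<Sum>n\<le>d. fps_nth (a n) d)"
  have "a sums ?F"
    unfolding sums_def tendsto_fps_iff
  proof
    fix d
    show "\<forall>\<^sub>F N in sequentially. fps_nth (sum a {..<N}) d = fps_nth ?F d"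
      using eventually_gt_at_top[of d]
    proof eventually_elim
      case (elim N)
      then show ?case
        by (auto simp: fps_sum_nth assms intro!: sum.mono_neutral_right intro: leI)
    qed
  qed
  then show ?thesis by (rule sums_summable)
qed

theorem theorem7p6:
  shows "summable (\<lambda>n. to_completion (exp_tri_term (x_part {#}) n)) \<and>
    summable (\<lambda>n. to_completion
      (qscale (1 / fact (n + 1)) (\<Sum>\<sigma> | \<sigma> permutes {1..n}. x_part (lehmer_partition n \<sigma>)))) \<and>
    exp_tri (x_part {#}) = suminf (\<lambda>n. to_completion
      (qscale (1 / fact (n + 1)) (\<Sum>\<sigma> | \<sigma> permutes {1..n}. x_part (lehmer_partition n \<sigma>))))"
proof -
  have "summable (\<lambda>n. to_completion (exp_tri_term (x_part {#}) n))"
    by (rule summable_fpsI) (simp add: to_completion_def x_part_empty homog_part_exp_tri_term)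
  \<comment> \<open>The two series agree term by term before completion, so the second summability
    and the equality of sums both follow from the first summability.\<close>
  moreover have "exp_tri_term (x_part {#}) n =
      qscale (1 / fact (n + 1)) (\<Sum>\<sigma> | \<sigma> permutes {1..n}. x_part (lehmer_partition n \<sigma>))" for n
    by (simp only: exp_tri_term_def x_part_empty tri_power_eq_sum_permutations)
  ultimately show ?thesis
    by (simp only: exp_tri_def)
qed

end
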